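(* Let $I \subset \widetilde{I} \subset \mathbb{R}$ be intervals containing $1$ as an interior point. Then the following are equivalent for a function $K : \widetilde{I} \to \mathbb{R}$ that is not identically zero on $\widetilde{I}$. (1) $K(1) \neq 0$, $K$ is Lebesgue measurable on $I$, and $K/K(1)$ is multiplicative on $\widetilde{I}$. (2) $K(1) \neq 0$, $K$ is monotone on each of $I_+ = I \cap (0,\infty)$ and $I_- = I \cap (-\infty, 0)$, and $K/K(1)$ is multiplicative on $\widetilde{I}$. (3) $K(1) \neq 0$, $K$ is continuous on $I \setminus \{0\}$, and $K/K(1)$ is multiplicative on $\widetilde{I}$. (4) $K(1) \neq 0$, $K$ is differentiable on $I \setminus \{0\}$, and $K/K(1)$ is multiplicative on $\widetilde{I}$. (5) Either $K$ is a nonzero constant on $\widetilde{I}$, or $K$ is a scalar multiple of $\phi_\alpha$ or $\psi_\alpha$ (on $\widetilde{I}$) for some $\alpha \in \mathbb{R}$.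
   Context: A function $F : \widetilde{I} \to \mathbb{R}$ is multiplicative on $\widetilde{I}$ if $F(xy) = F(x)F(y)$ whenever $x, y, xy \in \widetilde{I}$. For $\alpha \in \mathbb{R}$, define $\phi_\alpha, \psi_\alpha : \mathbb{R} \to \mathbb{R}$ by $\phi_\alpha(x) := |x|^\alpha$ and $\psi_\alpha(x) := \operatorname{sgn}(x)|x|^\alpha$ for $x \neq 0$, and $\phi_\alpha(0) = \psi_\alpha(0) := 0$ (for every $\alpha$, including $\alpha \le 0$). Regularity "on" a subset means regularity of the restriction of $K$ to that subset (one-sided differentiability at an endpoint belonging to $I$). Intervals may be open, closed, half-open, bounded or unbounded. *)

theory Defs
  imports "HOL-Analysis.Analysis"
begin

definition multiplicative_on :: "real set \<Rightarrow> (real \<Rightarrow> real) \<Rightarrow> bool" where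
  "multiplicative_on J F \<longleftrightarrow> (\<forall>x\<in>J. \<forall>y\<in>J. x * y \<in> J \<longrightarrow> F (x * y) = F x * F y)"

definition phi :: "real \<Rightarrow> real \<Rightarrow> real" where
  "phi \<alpha> x = (if x = 0 then 0 else \<bar>x\<bar> powr \<alpha>)"

definition psi :: "real \<Rightarrow> real \<Rightarrow> real" where
  "psi \<alpha> x = (if x = 0 then 0 else sgn x * \<bar>x\<bar> powr \<alpha>)"

text \<open>Non-strict monotonicity, in either direction.\<close>

definition monotonic_on :: "real set \<Rightarrow> (real \<Rightarrow> real) \<Rightarrow> bool" where
  "monotonic_on A F \<longleftrightarrow> mono_on A F \<or> antimono_on A F"

end

theory Submission
  imports Defs
begin

text \<open>
  Put \<open>F = K / K 1\<close>. Iterating \<open>F x = F (sqrt x)\<^sup>2\<close> shows that \<open>F > 0\<close> at the positive points of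
  \<open>J\<close>. Each of the regularity conditions makes \<open>ln \<circ> F\<close> bounded on some \<open>{1..1 + d}\<close>; in the measurable
  case this is the Steinhaus argument: if \<open>E\<close> has nearly full measure near \<open>1\<close>, then \<open>E\<close> and \<open>s E\<close>
  intersect for \<open>s\<close> close to \<open>1\<close>. Hence the locally additive function \<open>ln \<circ> F \<circ> exp\<close> is linear,
  that is, \<open>F\<close> is a power function on the positive points of \<open>J\<close>. The functional equation then
  determines \<open>F\<close> at negative points up to one common sign, and forces \<open>F 0 = 0\<close> unless \<open>F\<close> is
  constant.
\<close>

section \<open>Locally additive functions on an interval\<close>

lemma interval_add_mult_of_nat:
  fixes f :: "real \<Rightarrow> real"
  assumes L: "is_interval L" "0 \<in> L"
    and add: "\<And>s t. \<lbrakk>s \<in> L; t \<in> L; s + t \<in> L\<rbrakk> \<Longrightarrow> f (s + t) = f s + f t"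
  shows "real n * t \<in> L \<Longrightarrow> f (real n * t) = real n * f t"
proof (induction n)
  case 0
  then show ?case using add[of 0 0] by simp
next
  case (Suc n)
  \<comment> \<open>Additivity is available only while all terms stay in \<open>L\<close>; the
    intermediate multiples do, since they lie between \<open>0\<close> and the last one.\<close>
  have seg: "u * t \<in> L" if "0 \<le> u" "u \<le> real (Suc n)" for u
  proof (cases "t \<ge> 0")
    case True
    then show ?thesis
      using that mult_right_mono[of u "real (Suc n)" t]
      by (intro mem_is_interval_1_I[OF L Suc.prems]) auto
  next
    case False
    then show ?thesis
      using that mult_right_mono_neg[of u "real (Suc n)" t] mult_nonneg_nonpos[of u t]
      by (intro mem_is_interval_1_I[OF L(1) Suc.prems L(2)]) auto
  qed
  have n: "real n * t \<in> L" and t: "t \<in> L" using seg[of "real n"] seg[of 1] by auto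
  have "f (real n * t + t) = f (real n * t) + f t"
    using Suc.prems by (intro add n t) (simp add: algebra_simps)
  then show ?case using Suc.IH[OF n] by (simp add: algebra_simps)
qed

text \<open>For each \<open>N\<close>, \<open>h\<close> vanishes at the multiples of
  \<open>\<eta> / N\<close>, so \<open>h t = h r\<close> for the remainder \<open>r\<close> of
  \<open>t\<close> in \<open>{0..\<eta>}\<close>. As \<open>N * r\<close> is still in
  \<open>{0..\<eta>}\<close>, the bound applies there and gives
  \<open>N * \<bar>h t\<bar> \<le> M\<close> for every \<open>N \<ge> 1\<close>. Division by a large
  integer carries any other \<open>t\<close> into the range already treated, up to sign.\<close>

lemma interval_add_bounded_imp_zero:
  fixes h :: "real \<Rightarrow> real"
  assumes L: "is_interval L" and "\<eta> > 0" and sub: "{0..\<eta>} \<subseteq> L"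
    and add: "\<And>s t. \<lbrakk>s \<in> L; t \<in> L; s + t \<in> L\<rbrakk> \<Longrightarrow> h (s + t) = h s + h t"
    and bound: "\<And>t. t \<in> {0..\<eta>} \<Longrightarrow> \<bar>h t\<bar> \<le> M"
    and "h \<eta> = 0" and t: "t \<in> L"
  shows "h t = 0"
proof -
  have L0: "0 \<in> L" using sub \<open>\<eta> > 0\<close> by auto
  note mult = interval_add_mult_of_nat[OF L L0 add]
  have near: "h t = 0" if t: "t \<in> {0..\<eta>}" for t
  proof -
    have est: "real (Suc n) * \<bar>h t\<bar> \<le> M" for n
    proof -
      define N where "N = real (Suc n)"
      have "N > 0" by (simp add: N_def)
      \<comment> \<open>\<open>k\<close> counts the steps of length \<open>\<eta> / N\<close> that
        fit into \<open>t\<close>, so that the remainder \<open>r\<close> is at most one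
        step.\<close>
      define k where "k = nat \<lfloor>t * N / \<eta>\<rfloor>"
      have "t * N / \<eta> \<ge> 0" using t \<open>\<eta> > 0\<close> \<open>N > 0\<close> by simp
      then have k: "real k \<le> t * N / \<eta>" "t * N / \<eta> \<le> real k + 1"
        unfolding k_def by linarith+
      define r where "r = t - real k * (\<eta> / N)"
      have "N * r = t * N - real k * \<eta>" using \<open>N > 0\<close> by (simp add: r_def field_simps)
      moreover have "real k * \<eta> \<le> t * N" "t * N \<le> (real k + 1) * \<eta>"
        using k \<open>\<eta> > 0\<close> by (simp_all add: field_simps)
      ultimately have r: "0 \<le> r" "N * r \<le> \<eta>"
        using zero_le_mult_iff[of N r] \<open>N > 0\<close> by (auto simp: algebra_simps)
      have "r \<le> N * r" using r(1) by (simp add: N_def algebra_simps)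
      have kt: "real k * (\<eta> / N) \<in> {0..\<eta>}" using r t \<open>\<eta> > 0\<close> \<open>N > 0\<close> by (auto simp: r_def)
      have "h \<eta> = N * h (\<eta> / N)"
        using mult[of "Suc n" "\<eta> / N"] \<open>\<eta> > 0\<close> \<open>N > 0\<close> sub
        by (simp add: N_def subset_iff)
      then have "h (\<eta> / N) = 0" using \<open>h \<eta> = 0\<close> \<open>N > 0\<close> by simp
      then have "h (real k * (\<eta> / N)) = 0" using mult[of k "\<eta> / N"] kt sub by auto
      moreover have "h (real k * (\<eta> / N) + r) = h (real k * (\<eta> / N)) + h r"
        using kt sub r t \<open>r \<le> N * r\<close> by (intro add) (auto simp: r_def)
      ultimately have "h t = h r" by (simp add: r_def)
      moreover have "h (N * r) = N * h r"
        using mult[of "Suc n" r] r sub \<open>N > 0\<close>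
        by (simp add: N_def subset_iff)
      moreover have "\<bar>h (N * r)\<bar> \<le> M" using r \<open>N > 0\<close> by (intro bound) auto
      ultimately show ?thesis using \<open>N > 0\<close> by (simp add: N_def abs_mult)
    qed
    show ?thesis
    proof (rule ccontr)
      assume "h t \<noteq> 0"
      then obtain n where "M / \<bar>h t\<bar> < real n" using reals_Archimedean2 by blast
      then have "M < real n * \<bar>h t\<bar>" using \<open>h t \<noteq> 0\<close> by (simp add: field_simps)
      then show False using est[of n] \<open>h t \<noteq> 0\<close> by (simp add: algebra_simps)
    qed
  qed
  obtain n where n: "\<bar>t\<bar> / \<eta> < real n" using reals_Archimedean2 by blast
  have "\<bar>t\<bar> / \<eta> \<ge> 0" using \<open>\<eta> > 0\<close> by simp
  then have "real n > 0" using n by linarith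
  have tn: "\<bar>t\<bar> / real n \<in> {0..\<eta>}" using n \<open>real n > 0\<close> \<open>\<eta> > 0\<close> by (auto simp: field_simps)
  have ht: "h t = real n * h (t / real n)"
    using mult[of n "t / real n"] t \<open>real n > 0\<close> by simp
  show ?thesis
  proof (cases "t \<ge> 0")
    case True
    then show ?thesis using near[OF tn] ht by simp
  next
    \<comment> \<open>For negative \<open>t\<close> the point \<open>t / n\<close> may lie outside
      \<open>{0..\<eta>}\<close>, but its negative lies inside, and the two values of
      \<open>h\<close> add up to \<open>h 0 = 0\<close>.\<close>
    case False
    then have "- (t / real n) \<in> {0..\<eta>}" using tn by simp
    moreover have "t / real n \<in> L"
    proof (rule mem_is_interval_1_I[OF L t L0])
      show "t \<le> t / real n" using False \<open>real n > 0\<close> by (simp add: field_simps)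
      show "t / real n \<le> 0" using False by (simp add: divide_le_0_iff)
    qed
    moreover have "h 0 = 0" using add[of 0 0] L0 by simp
    ultimately have "h (t / real n) = 0"
      using add[of "t / real n" "- (t / real n)"] near[of "- (t / real n)"] sub L0
      by (simp add: subset_iff)
    then show ?thesis using ht by simp
  qed
qed

text \<open>Subtracting the linear function that agrees with \<open>f\<close> at
  \<open>\<eta>\<close> leaves an additive function, bounded on \<open>{0..\<eta>}\<close> and zero
  at \<open>\<eta>\<close>.\<close>

lemma interval_add_bounded_imp_linear:
  fixes f :: "real \<Rightarrow> real"
  assumes L: "is_interval L" and "\<eta> > 0" and sub: "{0..\<eta>} \<subseteq> L"
    and add: "\<And>s t. \<lbrakk>s \<in> L; t \<in> L; s + t \<in> L\<rbrakk> \<Longrightarrow> f (s + t) = f s + f t"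
    and bound: "\<And>t. t \<in> {0..\<eta>} \<Longrightarrow> \<bar>f t\<bar> \<le> M"
  shows "\<exists>c. \<forall>t\<in>L. f t = c * t"
proof -
  define c where "c = f \<eta> / \<eta>"
  have "f t - c * t = 0" if "t \<in> L" for t
  proof (rule interval_add_bounded_imp_zero[OF L \<open>\<eta> > 0\<close> sub, where h = "\<lambda>t. f t - c * t"])
    show "\<bar>f t - c * t\<bar> \<le> M + \<bar>c\<bar> * \<eta>" if "t \<in> {0..\<eta>}" for t
      using bound[OF that] that mult_left_mono[of t \<eta> "\<bar>c\<bar>"] abs_triangle_ineq4[of "f t" "c * t"]
      by (simp add: abs_mult)
  qed (use that \<open>\<eta> > 0\<close> in \<open>auto simp: add c_def algebra_simps add_divide_distrib\<close>)
  then show ?thesis by (intro exI[of _ c]) simp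
qed

section \<open>Multiplicative functions on an interval around 1\<close>

lemma interior_real_obtain_Icc:
  fixes a :: real
  assumes "a \<in> interior S"
  obtains d where "d > 0" "{a - d..a + d} \<subseteq> S"
  using assms unfolding mem_interior_cball by (auto simp: cball_eq_atLeastAtMost)

lemma sqrt_iterates_tendsto_1:
  fixes x :: real
  assumes "x > 0"
  shows "(\<lambda>k. (sqrt ^^ k) x) \<longlonglongrightarrow> 1"
proof -
  have "(sqrt ^^ k) x = x powr ((1/2) ^ k)" for k
  proof (induction k)
    case (Suc k)
    then show ?case by (simp add: powr_half_sqrt[symmetric] powr_powr mult.commute)
  qed (use assms in simp)
  moreover have "(\<lambda>k. x powr ((1/2) ^ k)) \<longlonglongrightarrow> x powr 0"
    using assms by (intro tendsto_powr tendsto_const LIMSEQ_power_zero) auto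
  ultimately show ?thesis using assms by simp
qed

lemma sqrt_between_1:
  fixes x :: real
  assumes "x > 0"
  shows "min x 1 \<le> sqrt x" "sqrt x \<le> max x 1"
proof -
  have sq: "sqrt x * sqrt x = x" using assms by simp
  have pos: "sqrt x > 0" using assms by simp
  show "min x 1 \<le> sqrt x"
  proof (cases "x \<le> 1")
    case True
    then have "sqrt x * sqrt x \<le> sqrt x * 1" using pos by (intro mult_left_mono) auto
    then show ?thesis using sq by simp
  qed simp
  show "sqrt x \<le> max x 1"
  proof (cases "x \<le> 1")
    case False
    then have "sqrt x * 1 \<le> sqrt x * sqrt x" using pos by (intro mult_left_mono) auto
    then show ?thesis using sq by simp
  qed simp
qed

text \<open>Only the algebraic hypotheses on \<open>F = K / K 1\<close> are collected here;
  regularity enters later, on some \<open>{1..1 + d}\<close>.\<close>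

locale interval_multiplicative =
  fixes J :: "real set" and F :: "real \<Rightarrow> real"
  assumes interval: "is_interval J"
    and one_interior: "1 \<in> interior J"
    and multiplicative: "multiplicative_on J F"
    and F_1: "F 1 = 1"
begin

lemma one_mem: "1 \<in> J"
  using one_interior interior_subset by blast

lemma F_mult: "\<lbrakk>x \<in> J; y \<in> J; x * y \<in> J\<rbrakk> \<Longrightarrow> F (x * y) = F x * F y"
  using multiplicative by (auto simp: multiplicative_on_def)

lemma sqrt_mem:
  assumes "x \<in> J" "x > 0"
  shows "sqrt x \<in> J"
proof (cases "x \<le> 1")
  case True
  then show ?thesis
    using sqrt_between_1[OF assms(2)] by (intro mem_is_interval_1_I[OF interval assms(1) one_mem]) auto
next
  case False
  then show ?thesis
    using sqrt_between_1[OF assms(2)] by (intro mem_is_interval_1_I[OF interval one_mem assms(1)]) auto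
qed

lemma F_sqrt: "\<lbrakk>x \<in> J; x > 0\<rbrakk> \<Longrightarrow> F x = (F (sqrt x))\<^sup>2"
  using F_mult[of "sqrt x" "sqrt x"] sqrt_mem[of x] by (simp add: power2_eq_square)

text \<open>\<open>F x\<close> is a square, so only \<open>F x = 0\<close> must be excluded. A zero
  passes to all iterated square roots of \<open>x\<close>. These tend to \<open>1\<close>, so some
  iterate has its inverse in \<open>J\<close>, and the product of the two would give
  \<open>F 1 = 0\<close>.\<close>

lemma F_pos:
  assumes "x \<in> J" "x > 0"
  shows "F x > 0"
proof -
  have "F x \<noteq> 0"
  proof
    assume zero: "F x = 0"
    have iter: "(sqrt ^^ k) x \<in> J \<and> (sqrt ^^ k) x > 0 \<and> F ((sqrt ^^ k) x) = 0" for k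
    proof (induction k)
      case (Suc k)
      then show ?case using sqrt_mem F_sqrt[of "(sqrt ^^ k) x"] by simp
    qed (use assms zero in simp)
    have "(\<lambda>k. inverse ((sqrt ^^ k) x)) \<longlonglongrightarrow> inverse 1"
      by (intro tendsto_inverse sqrt_iterates_tendsto_1 assms) simp
    then have "eventually (\<lambda>k. inverse ((sqrt ^^ k) x) \<in> interior J) sequentially"
      using one_interior by (intro topological_tendstoD) auto
    then obtain k where "inverse ((sqrt ^^ k) x) \<in> J"
      using interior_subset unfolding eventually_sequentially by blast
    then have "F ((sqrt ^^ k) x * inverse ((sqrt ^^ k) x)) = 0"
      using iter[of k] one_mem by (subst F_mult) auto
    then show False using iter[of k] F_1 by simp
  qed
  then show ?thesis using F_sqrt[OF assms] by simp
qed

text \<open>The substitution \<open>x = exp t\<close> turns products into sums and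
  \<open>{1..1 + d}\<close> into \<open>{0..ln (1 + d)}\<close>; the slope of the resulting linear
  function is the exponent.\<close>

lemma power_if_ln_bounded:
  assumes "d > 0" "{1..1 + d} \<subseteq> J" and bound: "\<And>x. x \<in> {1..1 + d} \<Longrightarrow> \<bar>ln (F x)\<bar> \<le> M"
  shows "\<exists>\<alpha>. \<forall>x\<in>J. x > 0 \<longrightarrow> F x = x powr \<alpha>"
proof -
  define L where "L = {t. exp t \<in> J}"
  have "\<exists>c. \<forall>t\<in>L. ln (F (exp t)) = c * t"
  proof (rule interval_add_bounded_imp_linear[where \<eta> = "ln (1 + d)" and M = M])
    show "is_interval L"
      unfolding is_interval_1 L_def
      using interval by (metis exp_le_cancel_iff is_interval_1 mem_Collect_eq)
    show "0 < ln (1 + d)" using \<open>d > 0\<close> by simp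
    have exp_mem: "exp t \<in> {1..1 + d}" if "t \<in> {0..ln (1 + d)}" for t
      using that \<open>d > 0\<close> by (auto simp: ln_ge_iff)
    show "{0..ln (1 + d)} \<subseteq> L" using exp_mem assms(2) by (auto simp: L_def)
    show "\<bar>ln (F (exp t))\<bar> \<le> M" if "t \<in> {0..ln (1 + d)}" for t
      by (intro bound exp_mem that)
    show "ln (F (exp (s + t))) = ln (F (exp s)) + ln (F (exp t))"
      if "s \<in> L" "t \<in> L" "s + t \<in> L" for s t
    proof -
      have "exp s \<in> J" "exp t \<in> J" "exp s * exp t \<in> J" using that by (auto simp: L_def exp_add)
      moreover from this have "F (exp s) > 0" "F (exp t) > 0" by (auto intro: F_pos)
      ultimately show ?thesis by (simp add: exp_add F_mult ln_mult)
    qed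
  qed
  then obtain c where c: "\<And>t. t \<in> L \<Longrightarrow> ln (F (exp t)) = c * t" by blast
  have "F x = x powr c" if "x \<in> J" "x > 0" for x
  proof -
    have "ln (F x) = c * ln x" using c[of "ln x"] that by (simp add: L_def)
    then show ?thesis using exp_ln[OF F_pos[OF that]] that by (simp add: powr_def)
  qed
  then show ?thesis by blast
qed

text \<open>A nonzero \<open>F 0\<close> can be cancelled from \<open>F 0 = F x * F 0\<close>.
  Otherwise \<open>F\<close> is known up to sign at one negative point \<open>b\<close>, from
  \<open>F (b * b)\<close>, and quotients of negative points, being positive, transport that sign to
  all of them.\<close>

lemma classification_if_power:
  assumes pow: "\<And>x. \<lbrakk>x \<in> J; x > 0\<rbrakk> \<Longrightarrow> F x = x powr \<alpha>"
  shows "(\<forall>x\<in>J. F x = 1) \<or> (\<forall>x\<in>J. F x = phi \<alpha> x) \<or> (\<forall>x\<in>J. F x = psi \<alpha> x)"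
proof (cases "0 \<in> J \<and> F 0 \<noteq> 0")
  case True
  have "F x = 1" if "x \<in> J" for x
    using F_mult[of x 0] that True by simp
  then show ?thesis by blast
next
  case F0: False
  show ?thesis
  proof (cases "\<exists>a\<in>J. a < 0")
    case False
    then have "x = 0 \<or> x > 0" if "x \<in> J" for x using that by force
    then have "\<forall>x\<in>J. F x = phi \<alpha> x" using F0 pow by (fastforce simp: phi_def)
    then show ?thesis by blast
  next
    case True
    then obtain a where a: "a \<in> J" "a < 0" by blast
    have Icc: "x \<in> J" if "a \<le> x" "x \<le> 1" for x
      using mem_is_interval_1_I[OF interval a(1) one_mem] that by blast
    \<comment> \<open>Truncating at \<open>-1\<close> puts \<open>b * b\<close> into
      \<open>(0, 1]\<close>, which lies in \<open>J\<close> because \<open>a < 0\<close>.\<close>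
    define b where "b = max a (-1)"
    have b: "b \<in> J" "b < 0" "b \<ge> -1" using a Icc[of b] by (auto simp: b_def)
    have "b * b \<le> 1" using b mult_mono[of "- b" 1 "- b" 1] by simp
    moreover have "b * b > 0" using b by (simp add: mult_neg_neg)
    ultimately have "b * b \<in> J" using a by (intro Icc) auto
    then have "F b * F b = (b * b) powr \<alpha>" using F_mult[of b b] pow[of "b * b"] b \<open>b * b > 0\<close> by simp
    also have "\<dots> = \<bar>b\<bar> powr \<alpha> * \<bar>b\<bar> powr \<alpha>"
      using powr_mult[of "\<bar>b\<bar>" "\<bar>b\<bar>" \<alpha>] by simp
    finally have Fb: "F b = \<bar>b\<bar> powr \<alpha> \<or> F b = - (\<bar>b\<bar> powr \<alpha>)"
      by (simp add: square_eq_iff)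
    \<comment> \<open>The order \<open>x \<le> y\<close> makes \<open>y / x\<close> at most
      \<open>1\<close>, hence a point of \<open>J\<close>. The cross-multiplied form is symmetric,
      so \<open>b\<close> can later be compared with points on either side.\<close>
    have ratio: "F x * \<bar>y\<bar> powr \<alpha> = F y * \<bar>x\<bar> powr \<alpha>"
      if "x \<in> J" "y \<in> J" "x \<le> y" "y < 0" for x y
    proof -
      have q: "y / x > 0" "y / x \<le> 1" using that by (auto simp: zero_less_divide_iff divide_le_eq)
      then have "y / x \<in> J" using a by (intro Icc) auto
      then have "F (y / x * x) = F (y / x) * F x" using that by (intro F_mult) auto
      then have "F y = (y / x) powr \<alpha> * F x" using pow[OF \<open>y / x \<in> J\<close> q(1)] that by simp
      moreover have "(y / x) powr \<alpha> = \<bar>y\<bar> powr \<alpha> / \<bar>x\<bar> powr \<alpha>"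
        using powr_divide[of "\<bar>y\<bar>" "\<bar>x\<bar>" \<alpha>] that by simp
      ultimately show ?thesis using that by (simp add: field_simps)
    qed
    have rb: "F x * \<bar>b\<bar> powr \<alpha> = F b * \<bar>x\<bar> powr \<alpha>" if "x \<in> J" "x < 0" for x
      using ratio[of x b] ratio[of b x] that b by (cases "x \<le> b") auto
    from Fb show ?thesis
    proof
      assume "F b = \<bar>b\<bar> powr \<alpha>"
      then have "F x = \<bar>x\<bar> powr \<alpha>" if "x \<in> J" "x < 0" for x using rb[OF that] b by simp
      then have "\<forall>x\<in>J. F x = phi \<alpha> x"
        using F0 pow by (auto simp: phi_def neq_iff)
      then show ?thesis by blast
    next
      assume "F b = - (\<bar>b\<bar> powr \<alpha>)"
      then have "F x = - (\<bar>x\<bar> powr \<alpha>)" if "x \<in> J" "x < 0" for x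
        using rb[OF that] b mult_right_cancel[of "\<bar>b\<bar> powr \<alpha>" "F x" "- (\<bar>x\<bar> powr \<alpha>)"]
        by (simp add: mult.commute)
      then have "\<forall>x\<in>J. F x = psi \<alpha> x"
        using F0 pow by (auto simp: psi_def neq_iff)
      then show ?thesis by blast
    qed
  qed
qed

text \<open>The sets \<open>E n\<close> increase to \<open>{1..1 + d}\<close>, so some
  \<open>E n\<close> has measure above \<open>3/4 * d\<close>. For \<open>s\<close> slightly above
  \<open>1\<close>, both \<open>E n\<close> and its dilate by \<open>s\<close> lie in an interval of
  length \<open>3/2 * d\<close>, so they meet. Then \<open>s\<close> is a quotient of two points of
  \<open>E n\<close>, which gives the bound \<open>2 * n\<close>.\<close>

lemma ln_bounded_if_measurable:
  assumes "d > 0" and sub: "{1..1 + d} \<subseteq> J"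
    and meas: "F \<in> borel_measurable (lebesgue_on {1..1 + d})"
  shows "\<exists>e M. e > 0 \<and> e \<le> d \<and> (\<forall>x\<in>{1..1 + e}. \<bar>ln (F x)\<bar> \<le> M)"
proof -
  define E where "E n = {x \<in> {1..1 + d}. \<bar>ln (F x)\<bar> \<le> real n}" for n :: nat
  have "{x \<in> space (lebesgue_on {1..1 + d}). \<bar>ln (F x)\<bar> \<le> real n} \<in> sets (lebesgue_on {1..1 + d})" for n
    using meas by measurable
  then have "E n \<in> sets (lebesgue_on {1..1 + d})" for n
    by (simp add: E_def)
  then have E_sets: "E n \<in> sets lebesgue" for n
    by (subst (asm) sets_restrict_space_iff) auto
  have E_lmeas: "E n \<in> lmeasurable" for n
    by (rule fmeasurableI2[of "{1..1 + d}", OF _ _ E_sets]) (auto simp: E_def)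
  have "(\<lambda>n. measure lebesgue (E n)) \<longlonglongrightarrow> measure lebesgue (\<Union>n. E n)"
  proof (rule Lim_measure_incseq)
    show "incseq E" by (auto simp: E_def incseq_def)
    have "emeasure lebesgue (\<Union>n. E n) \<le> emeasure lebesgue {1..1 + d}"
      by (rule emeasure_mono) (auto simp: E_def)
    then show "emeasure lebesgue (\<Union>n. E n) \<noteq> \<infinity>"
      using \<open>d > 0\<close> by (auto simp: top_unique)
  qed (use E_sets in auto)
  moreover have "(\<Union>n. E n) = {1..1 + d}" by (auto simp: E_def real_arch_simple)
  ultimately have "(\<lambda>n. measure lebesgue (E n)) \<longlonglongrightarrow> d" using \<open>d > 0\<close> by simp
  then have "eventually (\<lambda>n. measure lebesgue (E n) > 3/4 * d) sequentially"
    using \<open>d > 0\<close> by (intro order_tendstoD) auto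
  then obtain n where n: "measure lebesgue (E n) > 3/4 * d"
    by (auto simp: eventually_sequentially)
  \<comment> \<open>Solves \<open>(1 + e) * (1 + d) = 1 + 3/2 * d\<close>, so the dilates stay in an
    interval of length twice \<open>3/4 * d\<close>.\<close>
  define e where "e = d / (2 * (1 + d))"
  have e: "e > 0" "e \<le> d" using \<open>d > 0\<close> by (auto simp: e_def field_simps)
  have "\<bar>ln (F s)\<bar> \<le> 2 * real n" if s: "s \<in> {1..1 + e}" for s
  proof -
    have se: "s * (1 + d) \<le> 1 + 3/2 * d"
    proof -
      have "s * (1 + d) \<le> (1 + e) * (1 + d)" using s \<open>d > 0\<close> by (intro mult_right_mono) auto
      also have "\<dots> = 1 + 3/2 * d" using \<open>d > 0\<close> by (simp add: e_def field_simps)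
      finally show ?thesis .
    qed
    have "1 \<le> s * x" "s * x \<le> 1 + 3/2 * d" if "x \<in> E n" for x
      using that s mult_mono[of 1 s 1 x] order_trans[OF mult_left_mono se, of x]
      by (auto simp: E_def)
    then have sE_sub: "(*) s ` E n \<subseteq> {1..1 + 3/2 * d}" by auto
    \<comment> \<open>Writing the dilate as a preimage under scaling makes its Lebesgue
      measurability available.\<close>
    have "(*) s ` E n = (*\<^sub>R) (inverse s) -` E n \<inter> space lebesgue"
      using s by (auto simp: image_iff field_simps intro!: bexI[of _ "inverse s * _"])
    then have "(*) s ` E n \<in> sets lebesgue"
      using measurable_sets[OF lebesgue_measurable_scaling E_sets] by metis
    then have sE_lmeas: "(*) s ` E n \<in> lmeasurable"
      by (intro fmeasurableI2[OF _ sE_sub]) auto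
    have m_sE: "measure lebesgue ((*) s ` E n) = s * measure lebesgue (E n)"
      using measure_lebesgue_affine[of s 0 "E n"] s by simp
    have "(*) s ` E n \<inter> E n \<noteq> {}"
    proof
      assume disj: "(*) s ` E n \<inter> E n = {}"
      have "measure lebesgue ((*) s ` E n \<union> E n) = s * measure lebesgue (E n) + measure lebesgue (E n)"
        using disj m_sE measure_Un3[OF sE_lmeas E_lmeas[of n]] by simp
      moreover have "measure lebesgue ((*) s ` E n \<union> E n) \<le> measure lebesgue {1..1 + 3/2 * d}"
      proof (rule measure_mono_fmeasurable)
        show "(*) s ` E n \<union> E n \<subseteq> {1..1 + 3/2 * d}"
          using sE_sub \<open>d > 0\<close> by (force simp: E_def)
      qed (use sE_lmeas E_sets in auto)
      moreover have "measure lebesgue (E n) \<le> s * measure lebesgue (E n)"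
        using s by (simp add: mult_le_cancel_right1 measure_nonneg not_less)
      ultimately show False using n \<open>d > 0\<close> by simp
    qed
    then obtain x y where xy: "x \<in> E n" "y \<in> E n" "x = s * y" by blast
    have "s \<in> J" "y \<in> J" "s * y \<in> J" using xy s e sub by (auto simp: E_def)
    moreover have "s > 0" "y > 0" using s xy by (auto simp: E_def)
    ultimately have "ln (F x) = ln (F s) + ln (F y)"
      using F_pos[of s] F_pos[of y] xy(3) by (simp add: F_mult ln_mult)
    then show ?thesis using xy by (auto simp: E_def)
  qed
  then show ?thesis using e by blast
qed

text \<open>Monotonicity in either direction traps \<open>F x\<close> between \<open>F 1 = 1\<close>
  and \<open>F (1 + d)\<close>.\<close>

lemma ln_bounded_if_monotonic:
  assumes "d > 0" and sub: "{1..1 + d} \<subseteq> J" and mono: "monotonic_on {1..1 + d} F"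
    and x: "x \<in> {1..1 + d}"
  shows "\<bar>ln (F x)\<bar> \<le> \<bar>ln (F (1 + d))\<bar>"
proof -
  have pos: "F x > 0" "F (1 + d) > 0" using sub x \<open>d > 0\<close> by (auto intro!: F_pos)
  from mono consider "F 1 \<le> F x \<and> F x \<le> F (1 + d)" | "F (1 + d) \<le> F x \<and> F x \<le> F 1"
    using x \<open>d > 0\<close> by (auto simp: monotonic_on_def monotone_on_def)
  then show ?thesis
  proof cases
    case 1
    then have "0 \<le> ln (F x)" "ln (F x) \<le> ln (F (1 + d))" using pos F_1 by simp_all
    then show ?thesis by simp
  next
    case 2
    then have "ln (F x) \<le> 0" "ln (F (1 + d)) \<le> ln (F x)" using pos F_1 by simp_all
    then show ?thesis by simp
  qed
qed

end

section \<open>Regularity of signed power functions\<close>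

lemma monotonic_on_divide:
  assumes "monotonic_on A K"
  shows "monotonic_on A (\<lambda>x. K x / c)"
  using assms
  by (cases "c \<ge> 0")
    (auto simp: monotonic_on_def monotone_on_def divide_right_mono divide_right_mono_neg)

lemma monotonic_on_subset: "\<lbrakk>monotonic_on A K; B \<subseteq> A\<rbrakk> \<Longrightarrow> monotonic_on B K"
  by (auto simp: monotonic_on_def intro: monotone_on_subset)

lemma monotonic_on_cmult_powr:
  assumes "A \<subseteq> {0<..} \<or> A \<subseteq> {..<0}" and eq: "\<And>x. x \<in> A \<Longrightarrow> K x = c * \<bar>x\<bar> powr \<alpha>"
  shows "monotonic_on A K"
proof -
  have le: "\<bar>x\<bar> powr \<alpha> \<le> \<bar>y\<bar> powr \<alpha>" if "\<bar>x\<bar> \<le> \<bar>y\<bar>" "\<alpha> \<ge> 0" for x y :: real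
    using that by (intro powr_mono2) auto
  \<comment> \<open>The point \<open>x = 0\<close> is excluded because
    \<open>0 powr \<alpha> = 0\<close> even for negative \<open>\<alpha>\<close>.\<close>
  have ge: "\<bar>y\<bar> powr \<alpha> \<le> \<bar>x\<bar> powr \<alpha>" if "\<bar>x\<bar> \<le> \<bar>y\<bar>" "x \<noteq> 0" "\<alpha> < 0" for x y :: real
    using that by (intro powr_mono2') auto
  have "mono_on A (\<lambda>x. \<bar>x\<bar> powr \<alpha>) \<or> antimono_on A (\<lambda>x. \<bar>x\<bar> powr \<alpha>)"
    using assms(1)
  proof
    assume A: "A \<subseteq> {0<..}"
    show ?thesis
    proof (cases "\<alpha> \<ge> 0")
      case True
      then have "mono_on A (\<lambda>x. \<bar>x\<bar> powr \<alpha>)" using A by (intro mono_onI le) auto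
      then show ?thesis ..
    next
      case False
      then have "antimono_on A (\<lambda>x. \<bar>x\<bar> powr \<alpha>)" using A by (intro monotone_onI ge) auto
      then show ?thesis ..
    qed
  next
    assume A: "A \<subseteq> {..<0}"
    show ?thesis
    proof (cases "\<alpha> \<ge> 0")
      case True
      then have "antimono_on A (\<lambda>x. \<bar>x\<bar> powr \<alpha>)" using A by (intro monotone_onI le) auto
      then show ?thesis ..
    next
      case False
      then have "mono_on A (\<lambda>x. \<bar>x\<bar> powr \<alpha>)" using A by (intro mono_onI ge) auto
      then show ?thesis ..
    qed
  qed
  then show ?thesis
    by (cases "c \<ge> 0")
      (auto simp: monotonic_on_def monotone_on_def eq mult_left_mono mult_left_mono_neg)
qed

lemma differentiable_on_cong:
  assumes "f differentiable_on S" and "\<And>x. x \<in> S \<Longrightarrow> g x = f x"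
  shows "g differentiable_on S"
  using assms unfolding differentiable_on_def
  by (metis differentiable_transform_within zero_less_one)

lemma abs_powr_differentiable:
  fixes x :: real
  assumes "x \<noteq> 0"
  shows "(\<lambda>x. \<bar>x\<bar> powr \<alpha>) differentiable (at x within S)"
proof -
  \<comment> \<open>Squaring removes the absolute value and leaves a smooth base, positive away from
    \<open>0\<close>, for both signs of \<open>y\<close> at once.\<close>
  have "\<bar>y\<bar> powr \<alpha> = (y\<^sup>2) powr (\<alpha> / 2)" for y :: real
    using powr_powr[of "\<bar>y\<bar>" 2 "\<alpha> / 2"] by (cases "y = 0") (simp_all add: powr_numeral)
  moreover have "((\<lambda>x. (x\<^sup>2) powr (\<alpha> / 2)) has_real_derivative
      (x\<^sup>2) powr (\<alpha> / 2) * (0 * ln (x\<^sup>2) + (2 * x) * (\<alpha> / 2) / x\<^sup>2)) (at x)"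
    using assms by (intro DERIV_powr) (auto intro!: derivative_eq_intros)
  ultimately show ?thesis
    using real_differentiable_def differentiable_at_withinI by (metis (no_types, lifting) ext)
qed

lemma sgn_differentiable:
  fixes x :: real
  assumes "x \<noteq> 0"
  shows "sgn differentiable (at x within S)"
proof -
  have "(sgn has_real_derivative 0) (at x)"
  proof (rule DERIV_cong_ev[THEN iffD2, OF refl _ refl])
    show "eventually (\<lambda>y. sgn y = sgn x) (nhds x)"
    proof (cases "x > 0")
      case True
      then have "eventually (\<lambda>y. y \<in> {0<..}) (nhds x)" by (intro eventually_nhds_in_open) auto
      then show ?thesis by eventually_elim (use True in auto)
    next
      case False
      then have "eventually (\<lambda>y. y \<in> {..<0}) (nhds x)" using assms by (intro eventually_nhds_in_open) auto
      then show ?thesis by eventually_elim (use False assms in auto)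
    qed
  qed simp
  then show ?thesis using real_differentiable_def differentiable_at_withinI by blast
qed

text \<open>The sign is carried by a function \<open>s\<close> so that constants (\<open>\<alpha> = 0\<close>), \<open>phi\<close> and \<open>psi\<close> are treated alike.\<close>

lemma signed_power_regular:
  fixes K :: "real \<Rightarrow> real"
  assumes s: "s = (\<lambda>_. 1) \<or> s = sgn"
    and eq: "\<And>x. \<lbrakk>x \<in> I; x \<noteq> 0\<rbrakk> \<Longrightarrow> K x = c * (s x * \<bar>x\<bar> powr \<alpha>)"
  shows "monotonic_on (I \<inter> {0<..}) K" "monotonic_on (I \<inter> {..<0}) K" "K differentiable_on (I - {0})"
proof -
  show "monotonic_on (I \<inter> {0<..}) K"
    by (rule monotonic_on_cmult_powr[where c = c and \<alpha> = \<alpha>]) (use s eq in auto)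
  have "monotonic_on (I \<inter> {..<0}) K" if "s = (\<lambda>_. 1)"
    by (rule monotonic_on_cmult_powr[where c = c and \<alpha> = \<alpha>]) (use that eq in auto)
  moreover have "monotonic_on (I \<inter> {..<0}) K" if "s = sgn"
    by (rule monotonic_on_cmult_powr[where c = "- c" and \<alpha> = \<alpha>]) (use that eq in auto)
  ultimately show "monotonic_on (I \<inter> {..<0}) K" using s by blast
  show "K differentiable_on (I - {0})"
  proof (rule differentiable_on_cong)
    have "s differentiable (at x within I - {0})" if "x \<noteq> 0" for x
      using s sgn_differentiable[OF that] by auto
    then show "(\<lambda>x. c * (s x * \<bar>x\<bar> powr \<alpha>)) differentiable_on (I - {0})"
      unfolding differentiable_on_def by (auto intro!: differentiable_mult abs_powr_differentiable)
  qed (use eq in auto)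
qed

text \<open>The point \<open>a\<close> is a null set, so the uncontrolled value \<open>f a\<close>
  does not affect Lebesgue measurability.\<close>

lemma borel_measurable_lebesgue_on_if_continuous_on_punctured:
  fixes f :: "real \<Rightarrow> real"
  assumes "I \<in> sets lebesgue" and "continuous_on (I - {a}) f"
  shows "f \<in> borel_measurable (lebesgue_on I)"
proof -
  have "f \<in> borel_measurable (lebesgue_on (I - {a}))"
    using assms by (intro continuous_imp_measurable_on_sets_lebesgue) auto
  moreover have "{a} \<in> null_sets (lebesgue_on I)" if "a \<in> I"
    using that assms(1) by (simp add: null_sets_restrict_space)
  ultimately show ?thesis
    using borel_measurable_diff_null[of "{a}" I f] assms(1) by (cases "a \<in> I") auto
qed

lemma phi_mult: "phi \<alpha> (x * y) = phi \<alpha> x * phi \<alpha> y"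
  by (simp add: phi_def abs_mult powr_mult)

lemma psi_mult: "psi \<alpha> (x * y) = psi \<alpha> x * psi \<alpha> y"
  by (simp add: psi_def abs_mult sgn_mult powr_mult)

section \<open>Equivalence of the five conditions\<close>

theorem theorem2:
  fixes I J :: "real set" and K :: "real \<Rightarrow> real"
  assumes "is_interval I" and "is_interval J" and "I \<subseteq> J"
    and "1 \<in> interior I" and "1 \<in> interior J"
    and "\<exists>x\<in>J. K x \<noteq> 0"
  shows "let
      C1 = (K 1 \<noteq> 0 \<and> K \<in> borel_measurable (lebesgue_on I)
            \<and> multiplicative_on J (\<lambda>x. K x / K 1));
      C2 = (K 1 \<noteq> 0 \<and> monotonic_on (I \<inter> {0<..}) K \<and> monotonic_on (I \<inter> {..<0}) K
            \<and> multiplicative_on J (\<lambda>x. K x / K 1));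
      C3 = (K 1 \<noteq> 0 \<and> continuous_on (I - {0}) K
            \<and> multiplicative_on J (\<lambda>x. K x / K 1));
      C4 = (K 1 \<noteq> 0 \<and> K differentiable_on (I - {0})
            \<and> multiplicative_on J (\<lambda>x. K x / K 1));
      C5 = ((\<exists>c. c \<noteq> 0 \<and> (\<forall>x\<in>J. K x = c))
            \<or> (\<exists>\<alpha> c. (\<forall>x\<in>J. K x = c * phi \<alpha> x) \<or> (\<forall>x\<in>J. K x = c * psi \<alpha> x)))
    in (C1 \<longleftrightarrow> C2) \<and> (C2 \<longleftrightarrow> C3) \<and> (C3 \<longleftrightarrow> C4) \<and> (C4 \<longleftrightarrow> C5)"
proof -
  let ?F = "\<lambda>x. K x / K 1"
  let ?mult = "K 1 \<noteq> 0 \<and> multiplicative_on J ?F"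
  let ?meas = "K \<in> borel_measurable (lebesgue_on I)"
  let ?mono = "monotonic_on (I \<inter> {0<..}) K \<and> monotonic_on (I \<inter> {..<0}) K"
  let ?cont = "continuous_on (I - {0}) K"
  let ?diff = "K differentiable_on (I - {0})"
  let ?C5 = "(\<exists>c. c \<noteq> 0 \<and> (\<forall>x\<in>J. K x = c))
    \<or> (\<exists>\<alpha> c. (\<forall>x\<in>J. K x = c * phi \<alpha> x) \<or> (\<forall>x\<in>J. K x = c * psi \<alpha> x))"
  have I_sets: "I \<in> sets lebesgue"
    using real_interval_borel_measurable[OF assms(1)] by simp
  have "1 \<in> J" using assms(5) interior_subset by blast
  obtain d where d: "d > 0" "{1 - d..1 + d} \<subseteq> I"
    using interior_real_obtain_Icc[OF assms(4)] .
  then have dI: "{1..1 + d} \<subseteq> I" by auto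
  \<comment> \<open>Measurability and monotonicity suffice as cases: differentiability implies
    continuity, which implies measurability.\<close>
  have classify: "?C5" if mult: ?mult and reg: "?meas \<or> ?mono"
  proof -
    interpret interval_multiplicative J ?F
      using assms mult by unfold_locales auto
    have "\<exists>e M. e > 0 \<and> e \<le> d \<and> (\<forall>x\<in>{1..1 + e}. \<bar>ln (?F x)\<bar> \<le> M)"
      using reg
    proof
      assume ?meas
      then have "K \<in> borel_measurable (lebesgue_on {1..1 + d})"
        by (rule measurable_restrict_mono[OF _ dI])
      then show ?thesis
        using d dI assms(3) by (intro ln_bounded_if_measurable) auto
    next
      assume ?mono
      then have "monotonic_on {1..1 + d} ?F"
        using dI d(1) by (intro monotonic_on_divide) (auto intro: monotonic_on_subset)
      then show ?thesis
        using ln_bounded_if_monotonic[OF d(1)] d(1) dI assms(3) by blast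
    qed
    then obtain e M where e: "e > 0" "e \<le> d" "\<forall>x\<in>{1..1 + e}. \<bar>ln (?F x)\<bar> \<le> M" by blast
    have "\<exists>\<alpha>. \<forall>x\<in>J. x > 0 \<longrightarrow> ?F x = x powr \<alpha>"
    proof (rule power_if_ln_bounded[OF e(1)])
      show "{1..1 + e} \<subseteq> J" using e(2) dI assms(3) by force
    qed (use e(3) in auto)
    then obtain \<alpha> where "\<And>x. \<lbrakk>x \<in> J; x > 0\<rbrakk> \<Longrightarrow> ?F x = x powr \<alpha>" by blast
    from classification_if_power[OF this]
    have "(\<forall>x\<in>J. K x = K 1) \<or> (\<forall>x\<in>J. K x = K 1 * phi \<alpha> x) \<or> (\<forall>x\<in>J. K x = K 1 * psi \<alpha> x)"
      using mult by (simp add: divide_eq_eq mult.commute)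
    then show ?thesis using mult by blast
  qed
  have regular: "?mult \<and> ?mono \<and> ?diff" if ?C5
  proof -
    \<comment> \<open>All alternatives take the form \<open>K = c * G\<close> with \<open>G\<close>
      multiplicative on the whole line. The formula for \<open>G\<close> is required only off
      \<open>0\<close>, where the constant \<open>1\<close> (with \<open>\<alpha> = 0\<close>)
      differs from \<open>phi 0\<close>.\<close>
    obtain s \<alpha> c and G :: "real \<Rightarrow> real" where s: "s = (\<lambda>_. 1) \<or> s = sgn"
      and G_eq: "\<And>x. x \<noteq> 0 \<Longrightarrow> G x = s x * \<bar>x\<bar> powr \<alpha>"
      and G_mult: "\<And>x y. G (x * y) = G x * G y" and K: "\<And>x. x \<in> J \<Longrightarrow> K x = c * G x"
    proof -
      from that(1)[of "\<lambda>_. 1" "\<lambda>_. 1" 0] that(1)[of "\<lambda>_. 1" "phi \<alpha>" \<alpha> for \<alpha>]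
        that(1)[of sgn "psi \<alpha>" \<alpha> for \<alpha>] \<open>?C5\<close>
      show thesis
        by (auto simp: phi_mult psi_mult) (auto simp: phi_def psi_def)
    qed
    have "G 1 = 1" using s G_eq[of 1] by auto
    \<comment> \<open>The multiples of \<open>phi\<close> and \<open>psi\<close> allow
      \<open>c = 0\<close>; this is where \<open>K\<close> not vanishing identically on
      \<open>J\<close> enters.\<close>
    have "c \<noteq> 0" using assms(6) K by auto
    have "K 1 = c" using K[OF \<open>1 \<in> J\<close>] \<open>G 1 = 1\<close> by simp
    have "multiplicative_on J ?F"
      using K \<open>c \<noteq> 0\<close> by (simp add: multiplicative_on_def \<open>K 1 = c\<close> G_mult)
    moreover have "K x = c * (s x * \<bar>x\<bar> powr \<alpha>)" if "x \<in> I" "x \<noteq> 0" for x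
      using that K G_eq assms(3) by auto
    ultimately show ?thesis
      using \<open>c \<noteq> 0\<close> \<open>K 1 = c\<close> signed_power_regular[OF s, of I K c \<alpha>] by simp
  qed
  have "?diff \<Longrightarrow> ?cont" by (rule differentiable_imp_continuous_on)
  moreover have "?cont \<Longrightarrow> ?meas"
    by (rule borel_measurable_lebesgue_on_if_continuous_on_punctured[OF I_sets])
  ultimately show ?thesis
    unfolding Let_def using classify regular by blast
qed

end
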